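(* Let $\Sigma\cup\{\phi\}$ be a finite set of conditional independence and inclusion atoms. If $\Sigma\vdash\phi$, then $\Sigma\models\phi$.
   Context: Teams: for a model $\mathcal{M}$ with domain $M$, a team $X$ is a set of assignments (maps from a common finite set of variables $\mathrm{Dom}(X)$ into $M$). Atoms: $X$ satisfies the conditional independence atom $\vec y\perp_{\vec x}\vec z$ (tuples not necessarily disjoint) iff for all $s,s'\in X$ with $s(\vec x)=s'(\vec x)$ there is $s''\in X$ with $s''(\vec x)=s(\vec x)$, $s''(\vec y)=s(\vec y)$, $s''(\vec z)=s'(\vec z)$; $X$ satisfies the inclusion atom $\vec x\subseteq\vec y$ (tuples of equal length, repetitions allowed) iff for every $s\in X$ there is $s'\in X$ with $s(\vec x)=s'(\vec y)$. $\Sigma\models\phi$ means: for every model $\mathcal{M}$ and team $X$ with all variables of $\Sigma\cup\{\phi\}$ in $\mathrm{Dom}(X)$, if $X$ satisfies every atom of $\Sigma$ then $X$ satisfies $\phi$. Deduction system (besides conjunction introduction and elimination), where $\vec a,\vec b,\vec c,\vec x,\vec y,\vec z$ are tuples of variables: (1) Reflexivity: $\vec x\subseteq\vec x$. (2) Projection and Permutation: from $x_1\ldots x_n\subseteq y_1\ldots y_n$ infer $x_{i_1}\ldots x_{i_k}\subseteq y_{i_1}\ldots y_{i_k}$ for any sequence $i_1,\ldots,i_k$ from $\{1,\ldots,n\}$. (3) Transitivity: from $\vec x\subseteq\vec y$ and $\vec y\subseteq\vec z$ infer $\vec x\subseteq\vec z$. (4) Identity Rule: from $ab\subseteq cc$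 and $\phi$ (for variables $a,b,c$) infer $\phi'$, obtained from $\phi$ by replacing any number of occurrences of $a$ by $b$. (5) Inclusion Introduction: from $\vec a\subseteq\vec b$ infer $\vec a x\subseteq\vec b c$, where $x$ is a new variable. (6) Start Axiom: $\vec a\vec c\subseteq\vec a\vec x\wedge\vec b\perp_{\vec a}\vec x\wedge\vec a\vec x\subseteq\vec a\vec c$, where $\vec x$ is a sequence of pairwise distinct new variables. (7) Chase Rule: from $\vec y\perp_{\vec x}\vec z$, $\vec a\vec b\subseteq\vec x\vec y$ and $\vec a\vec c\subseteq\vec x\vec z$ infer $\vec a\vec b\vec c\subseteq\vec x\vec y\vec z$. (8) Final Rule: from $\vec a\vec c\subseteq\vec a\vec x$, $\vec b\perp_{\vec a}\vec x$ and $\vec a\vec b\vec x\subseteq\vec a\vec b\vec c$ infer $\vec b\perp_{\vec a}\vec c$. The new variables of an application of Inclusion Introduction (resp. Start Axiom) are $x$ (resp. those of $\vec x$). A deduction from $\Sigma$ is a sequence $(\phi_1,\ldots,\phi_n)$ where each $\phi_i$ is an element of $\Sigma$, an instance of Reflexivity or Start Axiom, or follows from formulas of $\Sigma\cup\{\phi_1,\ldots,\phi_{i-1}\}$ by one of the rules, and where, if $\phi_i$ is an instance of Start Axiom or obtained by Inclusion Introduction, its new variables do not appear in $\Sigma\cup\{\phi_1,\ldots,\phi_{i-1}\}$. $\Sigma\vdash\phi$ means there is a deduction $(\phi_1,\ldots,\phi_n)$ from $\Sigma$ with $\phi_n=\phi$ such that no variable of $\phi$ is a new variable of any step.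
   Formalization: In the Start Axiom the new variables x are also required not to occur in a, b, c; if only freshness for Σ and earlier formulas were required, b = x would be allowed and c ⊆ d would be derivable from d ⊆ c, so soundness would fail. *)

theory Defs
  imports Main "HOL-Library.FuncSet"
begin

text \<open>
  \<open>Indep x y z\<close> is the conditional independence atom "y is independent of z given x" and
  \<open>Incl x y\<close> the inclusion atom "x is included in y". Tuples are lists: they may be empty,
  overlap, or contain repetitions.
\<close>

datatype (avars: 'v) atom =
    Indep "'v list" "'v list" "'v list"
  | Incl "'v list" "'v list"

fun wf_atom :: "'v atom \<Rightarrow> bool" where
  "wf_atom (Indep x y z) \<longleftrightarrow> True"
| "wf_atom (Incl x y) \<longleftrightarrow> length x = length y"

datatype (fvars: 'v) fm =
    Atom "'v atom"
  | And "'v fm" "'v fm"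

text \<open>
  The atoms do not mention the vocabulary of a model, so a model is represented by its domain
  \<open>M\<close>, and \<open>V\<close> is the common domain Dom(X) of the assignments.
\<close>

definition team :: "'m set \<Rightarrow> 'v set \<Rightarrow> ('v \<Rightarrow> 'm) set \<Rightarrow> bool" where
  "team M V X \<longleftrightarrow> finite V \<and> X \<subseteq> V \<rightarrow>\<^sub>E M"

fun sat :: "('v \<Rightarrow> 'm) set \<Rightarrow> 'v atom \<Rightarrow> bool" where
  "sat X (Indep x y z) \<longleftrightarrow>
     (\<forall>s\<in>X. \<forall>s'\<in>X. map s x = map s' x \<longrightarrow>
       (\<exists>s''\<in>X. map s'' x = map s x \<and> map s'' y = map s y \<and> map s'' z = map s' z))"
| "sat X (Incl x y) \<longleftrightarrow> (\<forall>s\<in>X. \<exists>s'\<in>X. map s x = map s' y)"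

text \<open>
  The type argument bounds the universe from which model domains are taken. A theorem about
  \<open>entails TYPE('m)\<close> with \<open>'m\<close> a free type variable speaks about models of every size.
\<close>

definition entails :: "'m itself \<Rightarrow> 'v atom set \<Rightarrow> 'v atom \<Rightarrow> bool" where
  "entails (_ :: 'm itself) \<Sigma> \<phi> \<longleftrightarrow>
     (\<forall>(M :: 'm set) V X. team M V X \<longrightarrow> \<Union> (avars ` (\<Sigma> \<union> {\<phi>})) \<subseteq> V \<longrightarrow>
       (\<forall>\<psi>\<in>\<Sigma>. sat X \<psi>) \<longrightarrow> sat X \<phi>)"

text \<open>
  \<open>rule_inst \<Gamma> N \<psi>\<close>: \<open>\<psi>\<close> is an axiom instance or follows from formulas of \<open>\<Gamma>\<close> by one rule
  application with set of new variables \<open>N\<close>. That \<open>N\<close> is fresh for \<open>\<Gamma>\<close> is required in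
  \<open>deduction\<close> below. In \<open>start_axiom\<close> the new variables must also differ from the variables of
  \<open>a\<close>, \<open>b\<close> and \<open>c\<close>, which need not occur in \<open>\<Gamma>\<close>; without this the system is unsound, for
  instance when \<open>b = x\<close>. In \<open>inclusion_intro\<close> the variable \<open>c\<close> is arbitrary, even \<open>c = v\<close>. In \<open>identity\<close> the datatype relator says that \<open>\<phi>'\<close> has the shape of
  \<open>\<phi>\<close> and, at each variable occurrence, either the same variable or \<open>b\<close> in place of \<open>a\<close>.
\<close>

inductive rule_inst :: "'v fm set \<Rightarrow> 'v set \<Rightarrow> 'v fm \<Rightarrow> bool" for \<Gamma> where
  conj_intro:
    "\<phi> \<in> \<Gamma> \<Longrightarrow> \<psi> \<in> \<Gamma> \<Longrightarrow> rule_inst \<Gamma> {} (And \<phi> \<psi>)"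
| conj_elim1:
    "And \<phi> \<psi> \<in> \<Gamma> \<Longrightarrow> rule_inst \<Gamma> {} \<phi>"
| conj_elim2:
    "And \<phi> \<psi> \<in> \<Gamma> \<Longrightarrow> rule_inst \<Gamma> {} \<psi>"
| reflexivity:
    "rule_inst \<Gamma> {} (Atom (Incl x x))"
| projection:
    "Atom (Incl x y) \<in> \<Gamma> \<Longrightarrow> length x = length y \<Longrightarrow> set js \<subseteq> {..<length x} \<Longrightarrow>
     rule_inst \<Gamma> {} (Atom (Incl (map (\<lambda>j. x ! j) js) (map (\<lambda>j. y ! j) js)))"
| transitivity:
    "Atom (Incl x y) \<in> \<Gamma> \<Longrightarrow> Atom (Incl y z) \<in> \<Gamma> \<Longrightarrow> rule_inst \<Gamma> {} (Atom (Incl x z))"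
| identity:
    "Atom (Incl [a, b] [c, c]) \<in> \<Gamma> \<Longrightarrow> \<phi> \<in> \<Gamma> \<Longrightarrow>
     rel_fm (\<lambda>u v. v = u \<or> (u = a \<and> v = b)) \<phi> \<phi>' \<Longrightarrow> rule_inst \<Gamma> {} \<phi>'"
| inclusion_intro:
    "Atom (Incl a b) \<in> \<Gamma> \<Longrightarrow> rule_inst \<Gamma> {v} (Atom (Incl (a @ [v]) (b @ [c])))"
| start_axiom:
    "distinct x \<Longrightarrow> length x = length c \<Longrightarrow> set x \<inter> (set a \<union> set b \<union> set c) = {} \<Longrightarrow>
     rule_inst \<Gamma> (set x)
       (And (Atom (Incl (a @ c) (a @ x)))
         (And (Atom (Indep a b x)) (Atom (Incl (a @ x) (a @ c)))))"
| chase: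
    "Atom (Indep x y z) \<in> \<Gamma> \<Longrightarrow>
     Atom (Incl (a @ b) (x @ y)) \<in> \<Gamma> \<Longrightarrow> Atom (Incl (a @ c) (x @ z)) \<in> \<Gamma> \<Longrightarrow>
     length a = length x \<Longrightarrow> length b = length y \<Longrightarrow> length c = length z \<Longrightarrow>
     rule_inst \<Gamma> {} (Atom (Incl (a @ b @ c) (x @ y @ z)))"
| final:
    "Atom (Incl (a @ c) (a @ x)) \<in> \<Gamma> \<Longrightarrow> Atom (Indep a b x) \<in> \<Gamma> \<Longrightarrow>
     Atom (Incl (a @ b @ x) (a @ b @ c)) \<in> \<Gamma> \<Longrightarrow>
     rule_inst \<Gamma> {} (Atom (Indep a b c))"

text \<open>
  Each entry of a deduction pairs a formula with the new variables of the step that introduces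
  it, since the same formula may be justified in ways with different new variables.
\<close>

definition deduction :: "'v atom set \<Rightarrow> ('v fm \<times> 'v set) list \<Rightarrow> bool" where
  "deduction \<Sigma> D \<longleftrightarrow>
     (\<forall>i<length D.
       let \<Gamma> = Atom ` \<Sigma> \<union> fst ` set (take i D); (\<psi>, N) = D ! i
       in ((\<psi> \<in> Atom ` \<Sigma> \<and> N = {}) \<or> rule_inst \<Gamma> N \<psi>) \<and> N \<inter> \<Union> (fvars ` \<Gamma>) = {})"

definition derivable :: "'v atom set \<Rightarrow> 'v atom \<Rightarrow> bool" where
  "derivable \<Sigma> \<phi> \<longleftrightarrow>
     (\<exists>D. D \<noteq> [] \<and> deduction \<Sigma> D \<and> fst (last D) = Atom \<phi> \<and>
          avars \<phi> \<inter> \<Union> (snd ` set D) = {})"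

end

theory Submission
  imports Defs
begin

text \<open>
  A step with new variables \<open>N\<close> need not preserve the team \<open>X\<close>, but \<open>X\<close> can be replaced by a team
  with the same restriction to the complement of \<open>N\<close> that satisfies the new formula. All earlier
  formulas, being free of \<open>N\<close>, survive the replacement. The final team agrees with the original
  one on the variables of \<open>\<phi>\<close>, because none of them is ever new.

  Satisfaction of an atom depends neither on the domain of the model nor on the domain of the
  team, so the replacement teams are arbitrary sets of total functions.
\<close>

section \<open>Teams that agree off a set of variables\<close>

definition agree_off :: "'v set \<Rightarrow> ('v \<Rightarrow> 'm) set \<Rightarrow> ('v \<Rightarrow> 'm) set \<Rightarrow> bool" where
  "agree_off N = rel_set (\<lambda>s t. \<forall>v. v \<notin> N \<longrightarrow> s v = t v)"

lemma agree_off_refl: "agree_off N X X"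
  unfolding agree_off_def rel_set_def by blast

lemma agree_off_sym: "agree_off N X Y \<Longrightarrow> agree_off N Y X"
  unfolding agree_off_def rel_set_def by metis

lemma agree_off_trans: "agree_off N X Y \<Longrightarrow> agree_off N' Y Z \<Longrightarrow> agree_off (N \<union> N') X Z"
  unfolding agree_off_def rel_set_def by (metis UnCI)

text \<open>Both directions of \<open>rel_set\<close> enter: assignments of \<open>Y\<close> are
  pulled back to \<open>X\<close>, the atom supplies a witness there, and the witness is pushed
  forward to \<open>Y\<close>. Tuples that avoid \<open>N\<close> keep their values on the
  way.\<close>

lemma sat_agree_off:
  assumes "agree_off N X Y" "avars \<phi> \<inter> N = {}" "sat X \<phi>"
  shows "sat Y \<phi>"
proof -
  \<comment> \<open>The quantifier over \<open>xs\<close> stands inside, so that one counterpart of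
    \<open>t\<close> serves all tuples of the atom at once.\<close>
  have R: "\<exists>s\<in>X. \<forall>xs. set xs \<inter> N = {} \<longrightarrow> map s xs = map t xs" if t: "t \<in> Y" for t
  proof -
    obtain s where "s \<in> X" and s: "\<forall>v. v \<notin> N \<longrightarrow> s v = t v"
      using assms(1) t unfolding agree_off_def rel_set_def by blast
    moreover have "\<forall>xs. set xs \<inter> N = {} \<longrightarrow> map s xs = map t xs"
      using s by auto
    ultimately show ?thesis by blast
  qed
  have L: "\<exists>t\<in>Y. \<forall>xs. set xs \<inter> N = {} \<longrightarrow> map s xs = map t xs" if s: "s \<in> X" for s
  proof -
    obtain t where "t \<in> Y" and t: "\<forall>v. v \<notin> N \<longrightarrow> s v = t v"
      using assms(1) s unfolding agree_off_def rel_set_def by blast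
    moreover have "\<forall>xs. set xs \<inter> N = {} \<longrightarrow> map s xs = map t xs"
      using t by auto
    ultimately show ?thesis by blast
  qed
  show ?thesis
  proof (cases \<phi>)
    case (Indep x y z)
    then have d: "set x \<inter> N = {}" "set y \<inter> N = {}" "set z \<inter> N = {}"
      using assms(2) by auto
    have "\<exists>t''\<in>Y. map t'' x = map t x \<and> map t'' y = map t y \<and> map t'' z = map t' z"
      if "t \<in> Y" "t' \<in> Y" "map t x = map t' x" for t t'
    proof -
      obtain s where s: "s \<in> X" "\<And>xs. set xs \<inter> N = {} \<Longrightarrow> map s xs = map t xs"
        using R \<open>t \<in> Y\<close> by blast
      obtain s' where s': "s' \<in> X" "\<And>xs. set xs \<inter> N = {} \<Longrightarrow> map s' xs = map t' xs"
        using R \<open>t' \<in> Y\<close> by blast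
      have "map s x = map s' x"
        using s(2)[OF d(1)] s'(2)[OF d(1)] that(3) by (simp only:)
      then obtain s'' where s'': "s'' \<in> X" "map s'' x = map s x" "map s'' y = map s y"
          "map s'' z = map s' z"
        using assms(3) s(1) s'(1) unfolding Indep sat.simps by blast
      obtain t'' where "t'' \<in> Y" "\<And>xs. set xs \<inter> N = {} \<Longrightarrow> map s'' xs = map t'' xs"
        using L s''(1) by blast
      then show ?thesis
        using s'' s(2) s'(2) d by metis
    qed
    then show ?thesis unfolding Indep sat.simps by blast
  next
    case (Incl x y)
    then have "set x \<inter> N = {}" "set y \<inter> N = {}"
      using assms(2) by auto
    then show ?thesis
      using assms(3) L R unfolding Incl sat.simps by metis
  qed
qed

section \<open>Conjunctions and the replacement of variables with equal values\<close>

primrec sat_fm :: "('v \<Rightarrow> 'm) set \<Rightarrow> 'v fm \<Rightarrow> bool" where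
  "sat_fm X (Atom \<phi>) \<longleftrightarrow> sat X \<phi>"
| "sat_fm X (And \<phi> \<psi>) \<longleftrightarrow> sat_fm X \<phi> \<and> sat_fm X \<psi>"

lemma sat_fm_agree_off:
  "agree_off N X Y \<Longrightarrow> fvars \<phi> \<inter> N = {} \<Longrightarrow> sat_fm X \<phi> \<Longrightarrow> sat_fm Y \<phi>"
proof (induction \<phi>)
  case (Atom \<phi>)
  then show ?case by (auto intro: sat_agree_off)
next
  case (And \<phi> \<psi>)
  then show ?case by (simp add: Int_Un_distrib2)
qed

lemma map_eq_if_list_all2:
  assumes "list_all2 R xs ys" "\<And>u v. R u v \<Longrightarrow> s u = s v"
  shows "map s xs = map s ys"
  using assms by (induction rule: list_all2_induct) auto

text \<open>This is the semantic core of the Identity Rule. All assignments that the semantics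
  compares, witnesses included, lie in \<open>X\<close>, and each of them gives related tuples the
  same values.\<close>

lemma sat_rel_atom:
  assumes "rel_atom R \<phi> \<phi>'" "\<And>s u v. s \<in> X \<Longrightarrow> R u v \<Longrightarrow> s u = s v"
  shows "sat X \<phi> \<longleftrightarrow> sat X \<phi>'"
proof -
  have *: "map s xs = map s ys" if "s \<in> X" "list_all2 R xs ys" for s xs ys
    using map_eq_if_list_all2[OF that(2)] assms(2)[OF that(1)] by blast
  show ?thesis
  proof (cases \<phi>)
    case (Indep x y z)
    then obtain x' y' z' where \<phi>': "\<phi>' = Indep x' y' z'"
      and "list_all2 R x x'" "list_all2 R y y'" "list_all2 R z z'"
      using assms(1) by (cases \<phi>') auto
    then have "map s x = map s x'" "map s y = map s y'" "map s z = map s z'" if "s \<in> X" for s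
      using * that by blast+
    then show ?thesis by (simp add: Indep \<phi>' cong: ball_cong bex_cong)
  next
    case (Incl x y)
    then obtain x' y' where \<phi>': "\<phi>' = Incl x' y'"
      and "list_all2 R x x'" "list_all2 R y y'"
      using assms(1) by (cases \<phi>') auto
    then have "map s x = map s x'" "map s y = map s y'" if "s \<in> X" for s
      using * that by blast+
    then show ?thesis by (simp add: Incl \<phi>' cong: ball_cong bex_cong)
  qed
qed

lemma sat_fm_rel_fm:
  assumes "rel_fm R \<phi> \<phi>'" "\<And>s u v. s \<in> X \<Longrightarrow> R u v \<Longrightarrow> s u = s v"
  shows "sat_fm X \<phi> \<longleftrightarrow> sat_fm X \<phi>'"
  using assms(1)
proof (induction rule: fm.rel_induct)
  case (Atom \<phi> \<phi>')
  then show ?case using sat_rel_atom[OF _ assms(2)] by simp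
next
  case And
  then show ?case by simp
qed

section \<open>Soundness of the single rules\<close>

definition assign :: "('v \<Rightarrow> 'm) \<Rightarrow> 'v list \<Rightarrow> 'm list \<Rightarrow> 'v \<Rightarrow> 'm" where
  "assign s x ms v = (case map_of (zip x ms) v of None \<Rightarrow> s v | Some m \<Rightarrow> m)"

lemma assign_other: "v \<notin> set x \<Longrightarrow> assign s x ms v = s v"
proof -
  assume "v \<notin> set x"
  then have "map_of (zip x ms) v = None"
    by (auto simp: map_of_eq_None_iff dest: set_zip_leftD)
  then show ?thesis by (simp add: assign_def)
qed

lemma map_assign_other: "set y \<inter> set x = {} \<Longrightarrow> map (assign s x ms) y = map s y"
  by (auto intro: assign_other)

lemma map_assign_same: "distinct x \<Longrightarrow> length x = length ms \<Longrightarrow> map (assign s x ms) x = ms"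
  by (rule nth_equalityI) (auto simp: assign_def map_of_zip_nth)

text \<open>Fix a choice \<open>f\<close> of witnesses for the given inclusion and let the new
  variable record, at \<open>s\<close>, the value of \<open>c\<close> at \<open>f s\<close>. The
  updated \<open>f s\<close> is then a witness for the updated \<open>s\<close>.\<close>

lemma inclusion_intro_sound:
  assumes "sat X (Incl a b)" "v \<notin> set a" "v \<notin> set b"
  shows "\<exists>Y. agree_off {v} X Y \<and> sat Y (Incl (a @ [v]) (b @ [c]))"
proof -
  have "\<forall>s\<in>X. \<exists>s'. s' \<in> X \<and> map s a = map s' b"
    using assms(1) unfolding sat.simps by blast
  from bchoice[OF this] obtain f where f: "\<And>s. s \<in> X \<Longrightarrow> f s \<in> X \<and> map s a = map (f s) b"
    by blast
  \<comment> \<open>If \<open>c = v\<close>, the last component demands equal values of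
    \<open>v\<close> in an assignment and its witness, so a constant value is used. Otherwise the
    update leaves \<open>c\<close> alone.\<close>
  define g where "g s = (if c = v then undefined else f s c)" for s
  let ?Y = "(\<lambda>s. s(v := g s)) ` X"
  have "agree_off {v} X ?Y"
    unfolding agree_off_def rel_set_def by auto
  moreover have "\<exists>t'\<in>?Y. map t (a @ [v]) = map t' (b @ [c])" if t: "t \<in> ?Y" for t
  proof -
    obtain s where s: "s \<in> X" "t = s(v := g s)" using t by auto
    have "map t (a @ [v]) = map ((f s)(v := g (f s))) (b @ [c])"
      using f[OF s(1)] assms(2,3) by (simp add: s(2) g_def)
    then show ?thesis using f[OF s(1)] by blast
  qed
  ultimately show ?thesis unfolding sat.simps by blast
qed

lemma start_axiom_sound:
  assumes x: "distinct x" "length x = length c" "set x \<inter> (set a \<union> set b \<union> set c) = {}"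
  shows "\<exists>Y. agree_off (set x) X Y \<and> sat Y (Incl (a @ c) (a @ x)) \<and> sat Y (Indep a b x) \<and>
    sat Y (Incl (a @ x) (a @ c))"
proof -
  define h where "h s s' = assign s x (map s' c)" for s s' :: "'a \<Rightarrow> 'b"
  define Y where "Y = {h s s' | s s'. s \<in> X \<and> s' \<in> X \<and> map s a = map s' a}"
  have h: "map (h s s') a = map s a" "map (h s s') b = map s b" "map (h s s') c = map s c"
      "map (h s s') x = map s' c" for s s'
    unfolding h_def using x
    by (intro map_assign_other map_assign_same; fastforce)+
  have hY: "h s s' \<in> Y" if "s \<in> X" "s' \<in> X" "map s a = map s' a" for s s'
    using that unfolding Y_def by blast
  have Yh: "\<exists>s s'. t = h s s' \<and> s \<in> X \<and> s' \<in> X \<and> map s a = map s' a" if "t \<in> Y" for t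
    using that unfolding Y_def by blast
  have off: "h s s' v = s v" if "v \<notin> set x" for s s' v
    using that by (simp add: h_def assign_other)
  have "agree_off (set x) X Y"
    unfolding agree_off_def rel_set_def
  proof (intro conjI ballI)
    fix s assume "s \<in> X"
    then show "\<exists>t\<in>Y. \<forall>v. v \<notin> set x \<longrightarrow> s v = t v"
      by (intro bexI[of _ "h s s"]) (simp_all add: off hY)
  next
    fix t assume "t \<in> Y"
    then show "\<exists>s\<in>X. \<forall>v. v \<notin> set x \<longrightarrow> s v = t v"
      using Yh[of t] off by metis
  qed
  moreover have "\<exists>t'\<in>Y. map t (a @ c) = map t' (a @ x)"
    if t: "t \<in> Y" for t
  proof -
    obtain s s' where "t = h s s'" "s \<in> X"
      using Yh[OF t] by blast
    then show ?thesis
      \<comment> \<open>On the diagonal \<open>x\<close> carries the value that \<open>c\<close> has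
        at \<open>s\<close>, which is also its value at \<open>t\<close>.\<close>
      by (intro bexI[of _ "h s s"]) (simp_all only: map_append h hY)
  qed
  moreover have "\<exists>t''\<in>Y. map t'' a = map t a \<and> map t'' b = map t b \<and> map t'' x = map t' x"
    if t: "t \<in> Y" "t' \<in> Y" "map t a = map t' a" for t t'
  proof -
    obtain s s' where s: "t = h s s'" "s \<in> X"
      using Yh[OF t(1)] by blast
    obtain u u' where u: "t' = h u u'" "u' \<in> X" "map u a = map u' a"
      using Yh[OF t(2)] by blast
    have "map s a = map u' a"
      using t(3) u(3) by (simp only: s(1) u(1) h)
    then show ?thesis
      \<comment> \<open>Keep the first half of \<open>t\<close> and the second half of
        \<open>t'\<close>; the chain of equal values of \<open>a\<close> makes this pair
        admissible.\<close>
      using s u by (intro bexI[of _ "h s u'"]) (simp_all only: h hY simp_thms)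
  qed
  moreover have "\<exists>t'\<in>Y. map t (a @ x) = map t' (a @ c)"
    if t: "t \<in> Y" for t
  proof -
    obtain s s' where "t = h s s'" "s' \<in> X" "map s a = map s' a"
      using Yh[OF t] by blast
    then show ?thesis
      \<comment> \<open>The stored value comes from \<open>s'\<close>, so its diagonal pair has this
        value at \<open>c\<close>, and \<open>a\<close> agrees.\<close>
      by (intro bexI[of _ "h s' s'"]) (simp_all only: map_append h hY)
  qed
  ultimately show ?thesis unfolding sat.simps by blast
qed

text \<open>The witnesses of the two inclusions agree on \<open>x\<close>, because both reproduce
  the value of \<open>a\<close> at \<open>s\<close>. Independence then merges them into one
  witness.\<close>

lemma chase_sound:
  assumes "sat X (Indep x y z)" "sat X (Incl (a @ b) (x @ y))" "sat X (Incl (a @ c) (x @ z))"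
    and len: "length a = length x" "length b = length y" "length c = length z"
  shows "sat X (Incl (a @ b @ c) (x @ y @ z))"
  unfolding sat.simps
proof
  fix s assume "s \<in> X"
  obtain s1 where s1: "s1 \<in> X" "map s a = map s1 x" "map s b = map s1 y"
    using assms(2) \<open>s \<in> X\<close> len by fastforce
  obtain s2 where s2: "s2 \<in> X" "map s a = map s2 x" "map s c = map s2 z"
    using assms(3) \<open>s \<in> X\<close> len by fastforce
  have "map s1 x = map s2 x" using s1(2) s2(2) by (simp only:)
  then obtain t where "t \<in> X" "map t x = map s1 x" "map t y = map s1 y" "map t z = map s2 z"
    using assms(1) s1(1) s2(1) unfolding sat.simps by blast
  then show "\<exists>s'\<in>X. map s (a @ b @ c) = map s' (x @ y @ z)"
    using s1 s2 by (intro bexI[of _ t]) (simp_all only: map_append)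
qed

text \<open>The value of \<open>c\<close> at \<open>s'\<close> is first moved into \<open>x\<close>,
  then combined with \<open>a\<close> and \<open>b\<close> of \<open>s\<close> by independence, and
  finally moved back from \<open>x\<close> to \<open>c\<close> by the third premise.\<close>

lemma final_sound:
  assumes "sat X (Incl (a @ c) (a @ x))" "sat X (Indep a b x)"
    and "sat X (Incl (a @ b @ x) (a @ b @ c))"
  shows "sat X (Indep a b c)"
  unfolding sat.simps
proof (intro ballI impI)
  fix s s' assume s: "s \<in> X" "s' \<in> X" "map s a = map s' a"
  obtain t where t: "t \<in> X" "map t a = map s' a" "map t x = map s' c"
    using assms(1) s(2) by fastforce
  have "map s a = map t a" using s(3) t(2) by (simp only:)
  then obtain u where u: "u \<in> X" "map u a = map s a" "map u b = map s b" "map u x = map t x"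
    using assms(2) s(1) t(1) unfolding sat.simps by blast
  obtain w where "w \<in> X" "map w a = map u a" "map w b = map u b" "map w c = map u x"
    using assms(3) u(1) by fastforce
  then show "\<exists>s''\<in>X. map s'' a = map s a \<and> map s'' b = map s b \<and> map s'' c = map s' c"
    using t u by (intro bexI[of _ w]) (simp_all only: simp_thms)
qed

text \<open>Only Inclusion Introduction and the Start Axiom call for a changed team; in all other
  cases \<open>N\<close> is empty and \<open>Y = X\<close> works.\<close>

lemma rule_inst_sound:
  assumes "rule_inst \<Gamma> N \<psi>" "\<forall>\<phi>\<in>\<Gamma>. sat_fm X \<phi>" "N \<inter> \<Union> (fvars ` \<Gamma>) = {}"
  shows "\<exists>Y. agree_off N X Y \<and> sat_fm Y \<psi>"
proof -
  have prem: "sat X \<phi>" if "Atom \<phi> \<in> \<Gamma>" for \<phi>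
    using bspec[OF assms(2) that] by simp
  have same: ?thesis if "sat_fm X \<psi>" "N = {}"
    using that agree_off_refl by blast
  from assms(1) show ?thesis
  proof cases
    case (conj_intro \<phi> \<chi>)
    then show ?thesis using assms(2) by (intro same) simp_all
  next
    case (conj_elim1 \<chi>)
    then show ?thesis using bspec[OF assms(2) conj_elim1(2)] by (intro same) simp_all
  next
    case (conj_elim2 \<chi>)
    then show ?thesis using bspec[OF assms(2) conj_elim2(2)] by (intro same) simp_all
  next
    case (reflexivity x)
    then show ?thesis by (intro same) auto
  next
    case (projection x y js)
    have "\<exists>s'\<in>X. map s (map ((!) x) js) = map s' (map ((!) y) js)" if s: "s \<in> X" for s
    proof -
      obtain s' where s': "s' \<in> X" "map s x = map s' y"
        using prem[OF projection(3)] s unfolding sat.simps by blast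
      have "s (x ! j) = s' (y ! j)" if "j \<in> set js" for j
      proof -
        have "j < length x" "j < length y"
          using projection(4,5) that by auto
        then show ?thesis
          using arg_cong[OF s'(2), of "\<lambda>l. l ! j"] by (simp only: nth_map)
      qed
      then show ?thesis using s'(1) by (intro bexI[of _ s']) simp_all
    qed
    then show ?thesis
      unfolding projection(1,2) sat_fm.simps sat.simps using agree_off_refl by blast
  next
    case (transitivity x y z)
    have "sat X (Incl x z)"
      using prem[OF transitivity(3)] prem[OF transitivity(4)] unfolding sat.simps by metis
    then show ?thesis using transitivity by (intro same) simp_all
  next
    case (identity a b c \<phi>)
    \<comment> \<open>Both values equal the value of \<open>c\<close> at the witness for
      \<open>s\<close>.\<close>
    have "s a = s b" if "s \<in> X" for s
      using prem[OF identity(2)] that by auto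
    then have "sat_fm X \<phi> \<longleftrightarrow> sat_fm X \<psi>"
      by (intro sat_fm_rel_fm[OF identity(4)]) auto
    then show ?thesis using bspec[OF assms(2) identity(3)] identity(1) by (intro same) simp_all
  next
    case (inclusion_intro a b v c)
    have "fvars (Atom (Incl a b)) \<inter> {v} = {}"
      using assms(3) inclusion_intro(1,3) by blast
    then have "v \<notin> set a" "v \<notin> set b" by simp_all
    then show ?thesis
      unfolding inclusion_intro(1,2) sat_fm.simps
      by (rule inclusion_intro_sound[OF prem[OF inclusion_intro(3)]])
  next
    case (start_axiom x c a b)
    show ?thesis
      unfolding start_axiom(1,2) sat_fm.simps by (rule start_axiom_sound[OF start_axiom(3-5)])
  next
    case (chase x y z a b c)
    have "sat X (Incl (a @ b @ c) (x @ y @ z))"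
      using prem[OF chase(3)] prem[OF chase(4)] prem[OF chase(5)] chase(6-8) by (rule chase_sound)
    then show ?thesis using chase(1,2) by (intro same) simp_all
  next
    case (final a c x b)
    have "sat X (Indep a b c)"
      using prem[OF final(3)] prem[OF final(4)] prem[OF final(5)] by (rule final_sound)
    then show ?thesis using final(1,2) by (intro same) simp_all
  qed
qed

section \<open>Soundness of whole deductions\<close>

lemma deduction_sound:
  assumes D: "deduction \<Sigma> D" and X: "\<forall>\<psi>\<in>\<Sigma>. sat X \<psi>" and n: "n \<le> length D"
  shows "\<exists>Y. agree_off (\<Union> (snd ` set (take n D))) X Y \<and>
    (\<forall>\<psi>\<in>Atom ` \<Sigma> \<union> fst ` set (take n D). sat_fm Y \<psi>)"
  using n
proof (induction n)
  case 0
  then show ?case using X agree_off_refl by fastforce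
next
  case (Suc n)
  let ?\<Gamma> = "Atom ` \<Sigma> \<union> fst ` set (take n D)"
  obtain \<psi> N where Dn: "D ! n = (\<psi>, N)" by fastforce
  obtain Y where Y: "agree_off (\<Union> (snd ` set (take n D))) X Y" "\<forall>\<psi>\<in>?\<Gamma>. sat_fm Y \<psi>"
    using Suc by auto
  have "n < length D" using Suc.prems by simp
  then have "(\<psi> \<in> Atom ` \<Sigma> \<and> N = {} \<or> rule_inst ?\<Gamma> N \<psi>) \<and> N \<inter> \<Union> (fvars ` ?\<Gamma>) = {}"
    using D[unfolded deduction_def Let_def, THEN spec, of n] unfolding Dn prod.case by (rule rev_mp)
  then have step: "\<psi> \<in> Atom ` \<Sigma> \<and> N = {} \<or> rule_inst ?\<Gamma> N \<psi>" "N \<inter> \<Union> (fvars ` ?\<Gamma>) = {}"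
    by (blast dest: conjunct1 conjunct2)+
  \<comment> \<open>For an element of \<Sigma> take \<open>Z = Y\<close>, as \<open>N\<close> is
    empty; its truth in \<open>Y\<close> is part of the induction hypothesis, which carries \<Sigma>
    along for this reason.\<close>
  obtain Z where Z: "agree_off N Y Z" "sat_fm Z \<psi>"
    using step rule_inst_sound[of ?\<Gamma> N \<psi> Y] Y(2) agree_off_refl by blast
  have "sat_fm Z \<chi>" if "\<chi> \<in> ?\<Gamma>" for \<chi>
  proof -
    have "fvars \<chi> \<inter> N = {}" using step(2) that by fast
    moreover have "sat_fm Y \<chi>" using Y(2) that by (rule bspec)
    ultimately show ?thesis by (rule sat_fm_agree_off[OF Z(1)])
  qed
  moreover have "set (take (Suc n) D) = insert (\<psi>, N) (set (take n D))"
    using Suc.prems Dn by (simp add: take_Suc_conv_app_nth)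
  moreover have "agree_off (\<Union> (snd ` set (take n D)) \<union> N) X Z"
    using agree_off_trans Y(1) Z(1) by blast
  ultimately show ?case
    using Z(2) by (intro exI[of _ Z]) (simp add: Un_commute ball_Un)
qed

theorem theorem8:
  fixes \<Sigma> :: "'v atom set" and \<phi> :: "'v atom"
  assumes "finite (\<Sigma> \<union> {\<phi>})"
    and "\<forall>\<psi>\<in>\<Sigma> \<union> {\<phi>}. wf_atom \<psi>"
    and "derivable \<Sigma> \<phi>"
  shows "entails TYPE('m) \<Sigma> \<phi>"
proof -
  obtain D where D: "D \<noteq> []" "deduction \<Sigma> D" "fst (last D) = Atom \<phi>"
      "avars \<phi> \<inter> \<Union> (snd ` set D) = {}"
    using assms(3) unfolding derivable_def by blast
  have "sat X \<phi>" if X: "\<forall>\<psi>\<in>\<Sigma>. sat X \<psi>" for X :: "('v \<Rightarrow> 'm) set"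
  proof -
    obtain Y where Y: "agree_off (\<Union> (snd ` set D)) X Y" "\<forall>\<psi>\<in>fst ` set D. sat_fm Y \<psi>"
      using deduction_sound[OF D(2) X order_refl] by auto
    have "sat_fm Y (Atom \<phi>)"
      using Y(2) D(1,3) by (metis imageI last_in_set)
    then show ?thesis
      \<comment> \<open>Truth is transferred backwards here, from the final team \<open>Y\<close> to
        the given team \<open>X\<close>.\<close>
      using sat_agree_off[OF agree_off_sym[OF Y(1)] D(4)] by simp
  qed
  then show ?thesis unfolding entails_def by blast
qed

end
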